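(* Let $D=\mathbb{Z}[\omega]$ with $\omega=\frac{-1+i\sqrt{3}}{2}$. An element $\alpha\in D$ is a unit of $D$ if and only if $N\alpha=1$. Furthermore, the units of $D$ are exactly $1,-1,\omega,-\omega,\omega^{2},-\omega^{2}$.
   Context: For $\alpha=a+b\omega\in D$ with $a,b\in\mathbb{Z}$, the norm is $N\alpha=\alpha\overline{\alpha}=a^2-ab+b^2$. *)

theory Defs
  imports Complex_Main "HOL-Algebra.Ring"
begin

definition omega :: complex where
  "omega = (- 1 + \<i> * complex_of_real (sqrt 3)) / 2"

text \<open>The ring \<open>D = \<int>[\<omega>]\<close>, as a subring of the complex numbers. Because
  \<open>\<omega>\<^sup>2 = - 1 - \<omega>\<close>, its elements are exactly the integral combinations of \<open>1\<close> and \<open>\<omega>\<close>;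
  \<open>eisenstein_cring\<close> below confirms closure.\<close>

definition eisenstein :: "complex ring" where
  "eisenstein = \<lparr>carrier = {of_int a + of_int b * omega | a b :: int. True},
     mult = (*), one = 1, zero = 0, add = (+)\<rparr>"

definition eisenstein_norm :: "complex \<Rightarrow> complex" where
  "eisenstein_norm \<alpha> = \<alpha> * cnj \<alpha>"

lemma omega_square: "omega * omega = - 1 - omega"
  by (simp add: omega_def complex_eq_iff)

lemma eisenstein_norm_eq:
  "eisenstein_norm (of_int a + of_int b * omega) = of_int (a\<^sup>2 - a * b + b\<^sup>2)"
  by (simp add: eisenstein_norm_def omega_def complex_eq_iff power2_eq_square field_simps)

lemma eisenstein_carrierI:
  "x = of_int a + of_int b * omega \<Longrightarrow> x \<in> carrier eisenstein"
  unfolding eisenstein_def by auto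

lemma eisenstein_cring: "cring eisenstein"
proof (rule cringI)
  show "abelian_group eisenstein"
  proof (rule abelian_groupI)
    fix x y assume "x \<in> carrier eisenstein" "y \<in> carrier eisenstein"
    then obtain a b c d :: int
      where "x = of_int a + of_int b * omega" "y = of_int c + of_int d * omega"
      by (auto simp: eisenstein_def)
    then have "x + y = of_int (a + c) + of_int (b + d) * omega"
      by (simp add: algebra_simps)
    then have "x + y \<in> carrier eisenstein"
      by (rule eisenstein_carrierI)
    then show "x \<oplus>\<^bsub>eisenstein\<^esub> y \<in> carrier eisenstein"
      by (simp add: eisenstein_def)
  next
    fix x assume "x \<in> carrier eisenstein"
    then obtain a b :: int where "x = of_int a + of_int b * omega"
      by (auto simp: eisenstein_def)
    then have "- x \<in> carrier eisenstein"
      by (intro eisenstein_carrierI[of _ "- a" "- b"]) simp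
    then show "\<exists>y\<in>carrier eisenstein. y \<oplus>\<^bsub>eisenstein\<^esub> x = \<zero>\<^bsub>eisenstein\<^esub>"
      by (rule bexI[rotated]) (simp add: eisenstein_def)
  next
    have "0 \<in> carrier eisenstein"
      by (rule eisenstein_carrierI[of _ 0 0]) simp
    then show "\<zero>\<^bsub>eisenstein\<^esub> \<in> carrier eisenstein"
      by (simp add: eisenstein_def)
  qed (simp_all add: eisenstein_def algebra_simps)
  show "comm_monoid eisenstein"
  proof (rule comm_monoidI)
    fix x y assume "x \<in> carrier eisenstein" "y \<in> carrier eisenstein"
    then obtain a b c d :: int
      where xy: "x = of_int a + of_int b * omega" "y = of_int c + of_int d * omega"
      by (auto simp: eisenstein_def)
    have "x * y = of_int (a * c) + of_int (a * d + b * c) * omega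
        + of_int (b * d) * (omega * omega)"
      by (simp add: xy algebra_simps)
    also have "\<dots> = of_int (a * c - b * d) + of_int (a * d + b * c - b * d) * omega"
      unfolding omega_square by (simp add: algebra_simps)
    finally have "x * y \<in> carrier eisenstein"
      by (rule eisenstein_carrierI)
    then show "x \<otimes>\<^bsub>eisenstein\<^esub> y \<in> carrier eisenstein"
      by (simp add: eisenstein_def)
  next
    have "1 \<in> carrier eisenstein"
      by (rule eisenstein_carrierI[of _ 1 0]) simp
    then show "\<one>\<^bsub>eisenstein\<^esub> \<in> carrier eisenstein"
      by (simp add: eisenstein_def)
  qed (simp_all add: eisenstein_def algebra_simps)
qed (simp add: eisenstein_def algebra_simps)

end

theory Submission
  imports Defs
begin

text \<open>The norm is multiplicative with values in the nonnegative integers, so units have norm 1;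
  conversely \<open>\<alpha> * cnj \<alpha> = 1\<close> exhibits the conjugate, again in \<open>D\<close>, as an inverse. Completing the
  square in \<open>a\<^sup>2 - a * b + b\<^sup>2 = 1\<close> bounds both coordinates by 1 in absolute value, which leaves
  six solutions.\<close>

text \<open>The factor 4 keeps the completed square integral; the sum of squares gives both
  positivity and bounds.\<close>

lemma four_times_eisenstein_form:
  fixes a b :: int
  shows "4 * (a\<^sup>2 - a * b + b\<^sup>2) = (2 * a - b)\<^sup>2 + 3 * b\<^sup>2"
  by (simp add: power2_eq_square algebra_simps)

lemma eisenstein_form_nonneg:
  fixes a b :: int
  shows "0 \<le> a\<^sup>2 - a * b + b\<^sup>2"
proof -
  have "0 \<le> 4 * (a\<^sup>2 - a * b + b\<^sup>2)"
    unfolding four_times_eisenstein_form by simp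
  then show ?thesis
    by (simp only: zero_le_mult_iff) simp
qed

lemma eisenstein_form_eq_1_abs_le:
  fixes a b :: int
  assumes "a\<^sup>2 - a * b + b\<^sup>2 = 1"
  shows "\<bar>b\<bar> \<le> 1"
proof (rule ccontr)
  assume "\<not> \<bar>b\<bar> \<le> 1"
  \<comment> \<open>Now \<open>3 * b\<^sup>2\<close> is at least 12, while four times the form is
    only 4.\<close>
  then have "2\<^sup>2 \<le> \<bar>b\<bar>\<^sup>2"
    by (intro power_mono) auto
  then show False
    using four_times_eisenstein_form[of a b] zero_le_power2[of "2 * a - b"] assms by simp
qed

lemma eisenstein_form_eq_1_iff:
  fixes a b :: int
  shows "a\<^sup>2 - a * b + b\<^sup>2 = 1 \<longleftrightarrow>
    (a, b) \<in> {(1, 0), (-1, 0), (0, 1), (0, -1), (-1, -1), (1, 1)}"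
proof
  assume form: "a\<^sup>2 - a * b + b\<^sup>2 = 1"
  \<comment> \<open>The form is symmetric, so the bound on the second coordinate also applies to
    \<open>a\<close>.\<close>
  then have "b\<^sup>2 - b * a + a\<^sup>2 = 1"
    by (simp add: algebra_simps)
  then have "a \<in> {-1, 0, 1}" "b \<in> {-1, 0, 1}"
    using eisenstein_form_eq_1_abs_le[of b a] eisenstein_form_eq_1_abs_le[OF form] by auto
  \<comment> \<open>Of the nine remaining pairs, (0, 0) has value 0 and (1, -1), (-1, 1) have value
    3.\<close>
  then show "(a, b) \<in> {(1, 0), (-1, 0), (0, 1), (0, -1), (-1, -1), (1, 1)}"
    using form by auto
qed auto

lemma eisenstein_carrierE:
  assumes "x \<in> carrier eisenstein"
  obtains a b :: int where "x = of_int a + of_int b * omega"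
  using assms by (auto simp: eisenstein_def)

lemma eisenstein_norm_mult: "eisenstein_norm (x * y) = eisenstein_norm x * eisenstein_norm y"
  by (simp add: eisenstein_norm_def)

lemma eisenstein_cnj_closed:
  assumes "x \<in> carrier eisenstein"
  shows "cnj x \<in> carrier eisenstein"
proof -
  obtain a b :: int where "x = of_int a + of_int b * omega"
    using assms by (rule eisenstein_carrierE)
  \<comment> \<open>The conjugate of \<open>omega\<close> is its square, that is
    \<open>- 1 - omega\<close>.\<close>
  then have "cnj x = of_int (a - b) + of_int (- b) * omega"
    by (simp add: omega_def complex_eq_iff field_simps)
  then show ?thesis
    by (rule eisenstein_carrierI)
qed

lemma eisenstein_norm_unit:
  assumes "x \<in> Units eisenstein"
  shows "eisenstein_norm x = 1"
proof -
  obtain y where "x \<in> carrier eisenstein" "y \<in> carrier eisenstein" "x * y = 1"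
    using assms by (auto simp: Units_def eisenstein_def)
  then obtain a b c d :: int
    where x: "x = of_int a + of_int b * omega" and y: "y = of_int c + of_int d * omega"
    by (auto elim!: eisenstein_carrierE)
  let ?m = "a\<^sup>2 - a * b + b\<^sup>2" and ?n = "c\<^sup>2 - c * d + d\<^sup>2"
  have "eisenstein_norm x * eisenstein_norm y = 1"
    unfolding eisenstein_norm_mult[symmetric] \<open>x * y = 1\<close> by (simp add: eisenstein_norm_def)
  then have "of_int (?m * ?n) = (of_int 1 :: complex)"
    unfolding x y eisenstein_norm_eq by simp
  then have "?m * ?n = 1"
    by (simp only: of_int_eq_iff)
  \<comment> \<open>Integer factors of 1 are both 1 or both -1; nonnegativity excludes the
    latter.\<close>
  then have "?m = 1"
    using eisenstein_form_nonneg[of a b] zmult_eq_1_iff[of ?m ?n] by linarith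
  then show ?thesis
    unfolding x eisenstein_norm_eq by simp
qed

lemma Units_eisenstein_iff:
  "x \<in> Units eisenstein \<longleftrightarrow> x \<in> carrier eisenstein \<and> eisenstein_norm x = 1"
proof
  assume x: "x \<in> carrier eisenstein \<and> eisenstein_norm x = 1"
  then have "cnj x \<in> carrier eisenstein" "x * cnj x = 1"
    by (auto simp: eisenstein_cnj_closed eisenstein_norm_def)
  \<comment> \<open>\<open>Units\<close> asks for a two-sided inverse.\<close>
  moreover from this have "cnj x * x = 1"
    by (simp add: mult.commute)
  ultimately show "x \<in> Units eisenstein"
    using x by (auto simp: Units_def eisenstein_def intro!: bexI[of _ "cnj x"])
qed (auto simp: eisenstein_norm_unit Units_def)

text \<open>Passing to coordinates reduces listing the units to solving an equation over the
  integers.\<close>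

lemma Units_eisenstein_image:
  "Units eisenstein = (\<lambda>(a, b). of_int a + of_int b * omega) ` {(a, b). a\<^sup>2 - a * b + b\<^sup>2 = 1}"
proof -
  have "eisenstein_norm (of_int a + of_int b * omega) = 1 \<longleftrightarrow> a\<^sup>2 - a * b + b\<^sup>2 = 1" for a b :: int
    unfolding eisenstein_norm_eq by (rule of_int_eq_1_iff)
  then show ?thesis
    by (fastforce simp: Units_eisenstein_iff image_iff intro: eisenstein_carrierI
        elim!: eisenstein_carrierE)
qed

theorem proposition3p1:
  shows "(\<forall>\<alpha>\<in>carrier eisenstein. \<alpha> \<in> Units eisenstein \<longleftrightarrow> eisenstein_norm \<alpha> = 1)
    \<and> Units eisenstein = {1, - 1, omega, - omega, omega\<^sup>2, - (omega\<^sup>2)}"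
proof
  show "\<forall>\<alpha>\<in>carrier eisenstein. \<alpha> \<in> Units eisenstein \<longleftrightarrow> eisenstein_norm \<alpha> = 1"
    by (simp add: Units_eisenstein_iff)
  have "{(a, b). a\<^sup>2 - a * b + b\<^sup>2 = (1 :: int)} =
      {(1, 0), (-1, 0), (0, 1), (0, -1), (-1, -1), (1, 1)}"
    unfolding eisenstein_form_eq_1_iff by auto
  \<comment> \<open>The pairs (-1, -1) and (1, 1) yield \<open>omega\<^sup>2\<close> and its
    negative, by \<open>omega_square\<close>; the other four are immediate.\<close>
  then show "Units eisenstein = {1, - 1, omega, - omega, omega\<^sup>2, - (omega\<^sup>2)}"
    unfolding Units_eisenstein_image by (auto simp: power2_eq_square omega_square)
qed

end
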